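(* There is a morphism $h:\Sigma^*\to\Sigma^*$ over a binary alphabet $\Sigma$ that is abelian $16$-power free but not abelian $15$-power free, and that has an infinite fixed point which is abelian $14$-power free.
   Context: $\Sigma^*$ is the free monoid of finite words over $\Sigma$, with empty word $\epsilon$. A morphism is a monoid homomorphism $h:\Sigma^*\to\Sigma^*$; it extends to infinite words letter by letter, and an infinite word $\Omega$ is a fixed point of $h$ if $h(\Omega)=\Omega$. The Parikh vector $\psi(u)$ of a finite word $u$ records the number of occurrences of each letter in $u$. A word $u$ (finite or infinite) is abelian $k$-power free if whenever $u=xv_1\cdots v_ky$ with $\psi(v_1)=\cdots=\psi(v_k)$, one has $v_1=\cdots=v_k=\epsilon$. A morphism $h$ is abelian $n$-power free if $h(u)$ is abelian $n$-power free for every abelian $n$-power free word $u$. *)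

theory Defs
  imports Main "HOL-Library.Omega_Words_Fun"
begin

definition parikh :: "'a list \<Rightarrow> 'a \<Rightarrow> nat" where
  "parikh u = (\<lambda>a. count_list u a)"

definition word_morphism :: "('a list \<Rightarrow> 'b list) \<Rightarrow> bool" where
  "word_morphism h \<longleftrightarrow> h [] = [] \<and> (\<forall>u v. h (u @ v) = h u @ h v)"

text \<open>The list \<open>vs\<close> of length \<open>k\<close> holds the consecutive blocks of a
  factorisation \<open>x v\<^sub>1 \<dots> v\<^sub>k y\<close>; in the infinite case the tail \<open>y\<close> is infinite.\<close>

definition abelian_power_free :: "nat \<Rightarrow> 'a list \<Rightarrow> bool" where
  "abelian_power_free k u \<longleftrightarrow>
     (\<forall>x vs y. u = x @ concat vs @ y \<and> length vs = k \<and>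
        (\<forall>v\<in>set vs. \<forall>w\<in>set vs. parikh v = parikh w)
        \<longrightarrow> (\<forall>v\<in>set vs. v = []))"

definition abelian_power_free_inf :: "nat \<Rightarrow> 'a word \<Rightarrow> bool" where
  "abelian_power_free_inf k W \<longleftrightarrow>
     (\<forall>x vs (y :: 'a word). W = (x @ concat vs) \<frown> y \<and> length vs = k \<and>
        (\<forall>v\<in>set vs. \<forall>w\<in>set vs. parikh v = parikh w)
        \<longrightarrow> (\<forall>v\<in>set vs. v = []))"

definition abelian_power_free_morphism :: "nat \<Rightarrow> ('a list \<Rightarrow> 'b list) \<Rightarrow> bool" where
  "abelian_power_free_morphism n h \<longleftrightarrow>
     word_morphism h \<and> (\<forall>u. abelian_power_free n u \<longrightarrow> abelian_power_free n (h u))"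

text \<open>\<open>inf_image h W W'\<close> says that the infinite concatenation
  \<open>h(W 0) h(W 1) h(W 2) \<dots>\<close> is the infinite word \<open>W'\<close>. It is a relation because this
  concatenation is only a finite word when \<open>h\<close> erases all but finitely many letters of \<open>W\<close>;
  the second conjunct excludes that case.\<close>

definition inf_image :: "('a list \<Rightarrow> 'b list) \<Rightarrow> 'a word \<Rightarrow> 'b word \<Rightarrow> bool" where
  "inf_image h W W' \<longleftrightarrow>
     (\<forall>m. \<exists>y. W' = concat (map (\<lambda>i. h [W i]) [0..<m]) \<frown> y) \<and>
     (\<forall>n. \<exists>m. n \<le> length (concat (map (\<lambda>i. h [W i]) [0..<m])))"

definition inf_fixed_point :: "('a list \<Rightarrow> 'a list) \<Rightarrow> 'a word \<Rightarrow> bool" where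
  "inf_fixed_point h W \<longleftrightarrow> inf_image h W W"

end

theory Submission
  imports Defs
begin

text \<open>
  Take \<open>h(0) = 0000101\<close> and \<open>h(1) = 0\<^sup>8 1 0\<^sup>7\<close>, with \<open>W\<close> the limit of \<open>h\<^sup>n(0)\<close>. The Parikh
  vectors of \<open>h(0)\<close> and \<open>h(1)\<close> span the kernel of \<open>#0 - 15 #1\<close> modulo 25. Rounding a cut
  of \<open>h(u)\<close> to a cut of \<open>u\<close> leaves a difference of Parikh vectors that is determined by its
  residue, and the residues that occur are \<open>-7, \<dots>, 8\<close> and two more. An abelian 14-power in
  \<open>h(u)\<close> makes 15 of them an arithmetic progression, and this forces the common difference to be
  0 or \<open>\<plusminus>1\<close>. Hence the rounded cuts are the cuts of an abelian power in \<open>u\<close>, unless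
  they all coincide; then \<open>h(u)\<close> contains \<open>0\<^sup>1\<^sup>4\<close> across the boundary of \<open>h(1)h(1)\<close>.
  The factor \<open>11\<close> does not occur in \<open>W\<close>, while \<open>h(11)\<close> contains \<open>0\<^sup>1\<^sup>5\<close>. For a 16-power,
  17 residues in progression must be equal, as there are only 16 in the run \<open>-7, \<dots>, 8\<close>.
\<close>

section \<open>Abelian powers as arithmetic progressions of cuts\<close>

text \<open>Powers are stored by their cut positions because rounding acts on cuts, not on blocks.
  The increment \<open>V\<close> is integer-valued, so that differences of counts can serve as
  increments.\<close>

definition is_cuts :: "nat \<Rightarrow> 'a list \<Rightarrow> (nat \<Rightarrow> nat) \<Rightarrow> ('a \<Rightarrow> int) \<Rightarrow> bool" where
  "is_cuts k u s V \<longleftrightarrow> (\<forall>i<k. s i \<le> s (Suc i)) \<and> s k \<le> length u \<and>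
     (\<forall>i\<le>k. \<forall>a. int (count_list (take (s i) u) a) = int (count_list (take (s 0) u) a) + int i * V a)"

lemma count_list_concat_equal:
  assumes "\<forall>v\<in>set vs. count_list v a = n"
  shows "count_list (concat vs) a = length vs * n"
  using assms by (induction vs) auto

lemma is_cuts_le:
  assumes "is_cuts k u s V" "i \<le> j" "j \<le> k"
  shows "s i \<le> s j"
  using assms(2,3)
proof (induction j rule: dec_induct)
  case (step n)
  then show ?case using assms(1) unfolding is_cuts_def by (meson Suc_le_lessD le_trans Suc_leD)
qed simp

lemma not_abelian_power_free_cuts:
  assumes "\<not> abelian_power_free k u"
  obtains s V a where "is_cuts k u s V" "V a \<noteq> 0"
proof -
  from assms obtain x vs y v where u: "u = x @ concat vs @ y" and k: "length vs = k"
    and eq: "\<forall>v\<in>set vs. \<forall>w\<in>set vs. parikh v = parikh w" and v: "v \<in> set vs" "v \<noteq> []"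
    unfolding abelian_power_free_def by blast
  define s where "s i = length (x @ concat (take i vs))" for i
  have tk: "take (s i) u = x @ concat (take i vs)" if "i \<le> k" for i
  proof -
    have "u = (x @ concat (take i vs)) @ concat (drop i vs) @ y"
      unfolding u by (metis append.assoc append_take_drop_id concat_append)
    then show ?thesis unfolding s_def by (metis append_eq_conv_conj)
  qed
  have cnt: "count_list w a = count_list v a" if "w \<in> set vs" for w a
    using eq v that unfolding parikh_def by (metis (full_types))
  have "is_cuts k u s (\<lambda>a. int (count_list v a))"
    unfolding is_cuts_def
  proof (intro conjI allI impI)
    fix i assume "i < k"
    then show "s i \<le> s (Suc i)" using k by (simp add: s_def take_Suc_conv_app_nth)
  next
    show "s k \<le> length u" using k by (simp add: s_def u)
  next
    fix i a assume i: "i \<le> k"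
    have "count_list (concat (take i vs)) a = length (take i vs) * count_list v a"
      by (rule count_list_concat_equal) (meson cnt in_set_takeD)
    then have "count_list (concat (take i vs)) a = i * count_list v a" using i k by simp
    then show "int (count_list (take (s i) u) a)
      = int (count_list (take (s 0) u) a) + int i * int (count_list v a)"
      using tk[OF i] tk[of 0] by simp
  qed
  moreover have "int (count_list v (hd v)) \<noteq> 0"
    using v(2) by (simp add: count_list_0_iff)
  ultimately show thesis by (rule that)
qed

lemma cuts_not_abelian_power_free:
  assumes c: "is_cuts k u s V" and a: "V a \<noteq> 0" and k: "0 < k"
  shows "\<not> abelian_power_free k u"
proof -
  define b where "b i = take (s (Suc i) - s i) (drop (s i) u)" for i
  have take_step: "take (s (Suc i)) u = take (s i) u @ b i" if "i < k" for i
    using c that unfolding is_cuts_def b_def by (metis le_add_diff_inverse take_add)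
  have pre: "take (s i) u = take (s 0) u @ concat (map b [0..<i])" if "i \<le> k" for i
    using that by (induction i) (auto simp: take_step)
  have cnt: "int (count_list (b i) a) = V a" if "i < k" for i a
  proof -
    have e: "int (count_list (take (s j) u) a) = int (count_list (take (s 0) u) a) + int j * V a"
      if "j \<le> k" for j using c that unfolding is_cuts_def by blast
    have "int (count_list (take (s (Suc i)) u) a)
      = int (count_list (take (s i) u) a) + int (count_list (b i) a)"
      using take_step[OF that] by simp
    then show ?thesis using e[of i] e[of "Suc i"] that by (simp add: algebra_simps)
  qed
  have "u = take (s 0) u @ concat (map b [0..<k]) @ drop (s k) u"
    using pre[of k] by (metis append.assoc append_take_drop_id le_refl)
  moreover have "parikh v = parikh w"
    if "v \<in> set (map b [0..<k])" "w \<in> set (map b [0..<k])" for v w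
  proof
    fix a
    have "int (count_list v a) = V a" "int (count_list w a) = V a" using that cnt by auto
    then show "parikh v a = parikh w a" unfolding parikh_def by linarith
  qed
  moreover have "b 0 \<noteq> []" using cnt[of 0 a] a k by auto
  moreover have "b 0 \<in> set (map b [0..<k])" using k by simp
  ultimately show ?thesis unfolding abelian_power_free_def
    by (metis (no_types, lifting) length_map length_upt diff_zero)
qed

lemma short_abelian_power_free:
  assumes "length u < k"
  shows "abelian_power_free k u"
proof (rule ccontr)
  assume "\<not> ?thesis"
  then obtain s V a where c: "is_cuts k u s V" "V a \<noteq> 0"
    by (rule not_abelian_power_free_cuts)
  have "int (count_list (take (s k) u) a) = int (count_list (take (s 0) u) a) + int k * V a"
    using c(1) unfolding is_cuts_def by blast
  moreover have "count_list (take (s i) u) a \<le> length u" for i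
    using count_le_length[of "take (s i) u" a] by simp
  ultimately have "\<bar>int k * V a\<bar> \<le> int (length u)"
    by (smt (verit) of_nat_0_le_iff of_nat_mono)
  moreover have "int k * 1 \<le> int k * \<bar>V a\<bar>"
    using c(2) by (intro mult_left_mono) auto
  ultimately show False using assms by (simp add: abs_mult)
qed

section \<open>The morphism\<close>

definition img :: "bool \<Rightarrow> bool list" where
  "img a = (if a then replicate 8 False @ True # replicate 7 False else [False, False, False, False, True, False, True])"

definition mor :: "bool list \<Rightarrow> bool list" where
  "mor u = concat (map img u)"

lemma mor_simps [simp]: "mor [] = []" "mor (a # u) = img a @ mor u" "mor (u @ v) = mor u @ mor v"
  by (simp_all add: mor_def)

lemma count_list_replicate: "count_list (replicate n x) y = (if x = y then n else 0)"
  by (induction n) auto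

lemma length_img: "length (img True) = 16" "length (img False) = 7"
  by (simp_all add: img_def)

section \<open>Rounding the cuts of an image\<close>

text \<open>A cut of \<^term>\<open>mor u\<close> at position \<open>p\<close> is rounded to a cut of \<^term>\<open>u\<close>: downwards, except
  in the second half of the image of \<^term>\<open>True\<close>. The second component is the
  value of \<open>#False - 15 #True\<close> on the difference of the Parikh vectors.\<close>

fun rnd :: "bool list \<Rightarrow> nat \<Rightarrow> nat \<times> int" where
  "rnd [] p = (0, 0)"
| "rnd (False # u) p =
     (if p < 7 then (0, if p < 5 then int p else int p - 16)
      else apfst Suc (rnd u (p - 7)))"
| "rnd (True # u) p =
     (if p < 9 then (0, int p) else if p < 16 then (1, int p - 16)
      else apfst Suc (rnd u (p - 16)))"

text \<open>The cuts after 00001 and 000010 in the image of \<open>False\<close> give -11 and -10.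
  Its other cuts give 0 to 4, and the image of \<open>True\<close> gives -7 to 8.\<close>

abbreviation residues :: "int set" where
  "residues \<equiv> {-11, -10} \<union> {-7..8}"

lemma rnd_residue: "snd (rnd u p) \<in> residues"
proof (induction u p rule: rnd.induct)
  case (2 u p)
  then show ?case by (cases "p < 7") auto
next
  case (3 u p)
  then show ?case by (cases "p < 16") auto
qed simp

lemma rnd_le: "fst (rnd u p) \<le> length u"
  by (induction u p rule: rnd.induct) auto

lemma rnd_mono: "p \<le> q \<Longrightarrow> fst (rnd u p) \<le> fst (rnd u q)"
  by (induction u p arbitrary: q rule: rnd.induct) auto

text \<open>Only rounding up inside the image of \<open>True\<close> produces these
  residues.\<close>

lemma rnd_neg:
  assumes "snd (rnd u p) \<in> {-7..<0}"
  shows "0 < fst (rnd u p) \<and> u ! (fst (rnd u p) - 1)"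
  using assms
proof (induction u p rule: rnd.induct)
  case (2 u p)
  then show ?case by (cases "p < 7") (auto split: if_splits)
next
  case (3 u p)
  then show ?case by (cases "p < 16") (auto split: if_splits)
qed simp

text \<open>The image of \<open>False\<close> yields no residue above 4, so the cut lies in the
  first half of an image of \<open>True\<close>.\<close>

lemma rnd_pos:
  assumes "5 \<le> snd (rnd u p)"
  shows "fst (rnd u p) < length u \<and> u ! fst (rnd u p)"
  using assms
proof (induction u p rule: rnd.induct)
  case (2 u p)
  then show ?case by (cases "p < 7") (auto split: if_splits)
next
  case (3 u p)
  then show ?case by (cases "p < 16") (auto split: if_splits)
qed simp

abbreviation cnt :: "bool \<Rightarrow> nat \<Rightarrow> bool list \<Rightarrow> int" where
  "cnt a p u \<equiv> int (count_list (take p u) a)"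

text \<open>The number of occurrences of \<^term>\<open>True\<close> in the difference with residue \<open>g\<close>.\<close>

abbreviation high :: "int \<Rightarrow> int" where
  "high g \<equiv> (if g < -7 then 1 else 0)"

lemma lt7: "(p::nat) < 7 \<Longrightarrow> p \<in> {0,1,2,3,4,5,6}" by auto

lemma lt16: "(p::nat) < 16 \<Longrightarrow> p \<in> {0,1,2,3,4,5,6,7,8,9,10,11,12,13,14,15}"
  by (auto simp: numeral_eq_Suc less_Suc_eq)

text \<open>The Parikh matrix of \<open>mor\<close> has columns (5, 2) and (15, 1); the residue
  alone determines the remainder left by rounding.\<close>

lemma cnt_mor:
  assumes "p \<le> length (mor u)"
  shows "cnt True p (mor u)
      = 2 * cnt False (fst (rnd u p)) u + cnt True (fst (rnd u p)) u + high (snd (rnd u p)) \<and>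
    cnt False p (mor u)
      = 5 * cnt False (fst (rnd u p)) u + 15 * cnt True (fst (rnd u p)) u
        + snd (rnd u p) + 15 * high (snd (rnd u p))"
  using assms
proof (induction u p rule: rnd.induct)
  case (2 u p)
  show ?case
  proof (cases "p < 7")
    case True
    from lt7[OF this] show ?thesis by (auto simp: img_def)
  next
    case False
    with 2 have IH: "p - 7 \<le> length (mor u)" by (simp add: length_img)
    from False have "take p (img False) = img False" by (simp add: length_img)
    with False 2(1)[OF False IH] show ?thesis
      by (auto simp: length_img) (auto simp: img_def)
  qed
next
  case (3 u p)
  show ?case
  proof (cases "p < 16")
    case True
    from lt16[OF this] show ?thesis by (elim insertE emptyE) (simp_all add: img_def count_list_replicate)
  next
    case False
    with 3 have IH: "p - 16 \<le> length (mor u)" by (simp add: length_img)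
    from False have "take p (img True) = img True" by (simp add: length_img)
    with False 3(1)[OF _ False IH] show ?thesis
      by (auto simp: length_img) (auto simp: img_def count_list_replicate)
  qed
qed simp

section \<open>Progressions of residues modulo 25\<close>

text \<open>The classes modulo 25 that miss \<open>residues\<close> are 9 to 13, 16 and 17. Trying
  every start and step shows that only the steps 0, 1 and -1 (here 24) can avoid them for 15
  terms.\<close>

lemma residue_progression_check:
  "list_all (\<lambda>c. list_all (\<lambda>d. d \<in> {0, 1, 24} \<or>
     list_ex (\<lambda>i. let r = (c + i * d) mod 25 in 8 < r \<and> r \<noteq> 14 \<and> r \<noteq> 15 \<and> r < 18)
       [0..14]) [0..24]) [0..24::int]"
  by code_simp

lemma residue_mod:
  assumes "g \<in> residues" "r = g mod 25"
  shows "\<not> (8 < r \<and> r \<noteq> 14 \<and> r \<noteq> 15 \<and> r < 18)"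
proof -
  have "r = (if g < 0 then g + 25 else g)"
    using assms mod_pos_pos_trivial[of g 25] mod_pos_pos_trivial[of "g + 25" 25]
    by (auto simp del: mod_pos_pos_trivial)
  then show ?thesis using assms(1) by (auto split: if_splits)
qed

lemma residue_progression_mod:
  assumes g: "\<And>i. i \<le> 14 \<Longrightarrow> g i \<in> residues"
    and ap: "\<And>i. i \<le> 14 \<Longrightarrow> 25 dvd g i - (c + int i * d)"
  shows "d mod 25 \<in> {0, 1, 24}"
proof (rule ccontr)
  assume d: "d mod 25 \<notin> {0, 1, 24}"
  have "c mod 25 \<in> set [0..24]" "d mod 25 \<in> set [0..24]" by simp_all
  with d obtain j r where j: "j \<in> set [0..14]"
    and r: "r = (c mod 25 + j * (d mod 25)) mod 25"
    and n: "8 < r \<and> r \<noteq> 14 \<and> r \<noteq> 15 \<and> r < 18"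
    using residue_progression_check unfolding list_all_iff list_ex_iff Let_def by blast
  define i where "i = nat j"
  have i: "i \<le> 14" "j = int i" using j by (auto simp: i_def)
  have "r = (c + int i * d) mod 25"
    unfolding r i(2) by (intro mod_add_cong mod_mult_cong mod_mod_trivial refl)
  also have "\<dots> = g i mod 25"
    using ap[OF i(1)] by (simp add: mod_eq_dvd_iff dvd_diff_commute)
  finally show False using residue_mod[OF g[OF i(1)]] n by blast
qed

lemma residue_progression:
  assumes g: "\<And>i. i \<le> k \<Longrightarrow> g i \<in> residues" and k: "14 \<le> k"
    and ap: "\<And>i. i \<le> k \<Longrightarrow> 25 dvd g i - (c + int i * d)"
  obtains e where "e \<in> {-1, 0, 1}" "\<And>i. i \<le> k \<Longrightarrow> g i = g 0 + int i * e"
    "e \<noteq> 0 \<Longrightarrow> (\<forall>i\<le>k. g i \<in> {-7..8}) \<and> k \<le> 15"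
proof -
  have "d mod 25 \<in> {0, 1, 24}"
    using residue_progression_mod[of g c d] g ap k by auto
  then have "\<exists>e\<in>{-1, 0, 1}. 25 dvd d - e"
    by (auto; presburger)
  then obtain e where e: "e \<in> {-1, 0, 1}" "25 dvd d - e" by blast
  have step: "g (Suc i) = g i + e" if "Suc i \<le> k" for i
  proof -
    have "25 dvd (g (Suc i) - (c + int (Suc i) * d)) - (g i - (c + int i * d)) + (d - e)"
      using ap[OF that] ap[of i] that e(2) by (intro dvd_add[OF dvd_diff]) auto
    then have "25 dvd g (Suc i) - g i - e" by (simp add: algebra_simps)
    \<comment> \<open>Both residues lie in a window of 20 integers and \<open>e\<close> has size at
      most 1, so this multiple of 25 has size at most 20 and vanishes.\<close>
    moreover have "g i \<in> {-11..8}" "g (Suc i) \<in> {-11..8}"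
      using g[of i] g[OF that] that by auto
    ultimately show ?thesis using e(1) by (auto; presburger)
  qed
  have lin: "g i = g 0 + int i * e" if "i \<le> k" for i
    using that by (induction i) (auto simp: step algebra_simps)
  have "(\<forall>i\<le>k. g i \<in> {-7..8}) \<and> k \<le> 15" if "e \<noteq> 0"
  proof -
    \<comment> \<open>Two unit steps in one direction from -11 or -10 end at -13, -12, -9 or -8,
      none of them a residue. Looking two terms inwards from each end thus puts both ends into the
      run -7 to 8.\<close>
    have in0: "g 0 \<in> residues" using g by blast
    have ink: "g 0 + int k * e \<in> residues" using g[of k] lin[of k] by simp
    have in2: "g 0 + 2 * e \<in> residues" using g[of 2] lin[of 2] k by simp
    have ink2: "g 0 + int (k - 2) * e \<in> residues" using g[of "k - 2"] lin[of "k - 2"] by simp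
    have b: "g 0 \<in> {-7..8} \<and> g 0 + int k * e \<in> {-7..8}"
      using in0 ink in2 ink2 e(1) that k by auto
    have "g i \<in> {-7..8}" if "i \<le> k" for i
      using b e(1) lin[OF that] that by auto
    moreover have "k \<le> 15" using b e(1) that by (elim insertE emptyE) simp_all
    ultimately show ?thesis by blast
  qed
  with e(1) lin that show thesis by blast
qed

section \<open>Desubstitution\<close>

text \<open>The bound on \<open>k\<close> will exclude 16-powers, and the factor 11 in
  \<open>u\<close> will exclude 14-powers in the iterates.\<close>

lemma desubstitute:
  assumes cuts: "is_cuts k (mor u) s V" and V: "V a \<noteq> 0" and k: "14 \<le> k"
    and free: "abelian_power_free k u"
  shows "k \<le> 15 \<and> (\<exists>m. Suc m < length u \<and> u ! m \<and> u ! Suc m)"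
proof -
  define m g where "m i = fst (rnd u (s i))" and "g i = snd (rnd u (s i))" for i
  have le: "s i \<le> length (mor u)" if "i \<le> k" for i
    using is_cuts_le[OF cuts that] cuts unfolding is_cuts_def by (meson le_refl le_trans)
  have ap: "cnt a (s i) (mor u) = cnt a (s 0) (mor u) + int i * V a" if "i \<le> k" for a i
    using cuts that unfolding is_cuts_def by blast
  have T: "cnt True (s i) (mor u) = 2 * cnt False (m i) u + cnt True (m i) u + high (g i)"
    and F: "cnt False (s i) (mor u)
      = 5 * cnt False (m i) u + 15 * cnt True (m i) u + g i + 15 * high (g i)" if "i \<le> k" for i
    using cnt_mor[OF le[OF that]] unfolding m_def g_def by blast+
  have res: "g i \<in> residues" for i unfolding g_def by (rule rnd_residue)
  define c d where "c = cnt False (s 0) (mor u) - 15 * cnt True (s 0) (mor u)"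
    and "d = V False - 15 * V True"
  \<comment> \<open>Subtracting 15 times \<open>T\<close> from \<open>F\<close> cancels
    \<open>cnt True (m i) u\<close> and the \<open>high\<close> terms.\<close>
  have key: "g i = c + int i * d + 25 * cnt False (m i) u" if "i \<le> k" for i
    using T[OF that] F[OF that] ap[OF that, of True] ap[OF that, of False]
    unfolding c_def d_def by (simp add: algebra_simps)
  have dv: "25 dvd g i - (c + int i * d)" if "i \<le> k" for i
    using key[OF that] by simp
  obtain e where e: "e \<in> {-1, 0, 1}" "\<And>i. i \<le> k \<Longrightarrow> g i = g 0 + int i * e"
    "e \<noteq> 0 \<Longrightarrow> (\<forall>i\<le>k. g i \<in> {-7..8}) \<and> k \<le> 15"
    by (rule residue_progression[of k g c d, OF res k dv]) blast+
  \<comment> \<open>Either \<open>e\<close> is 0 and the residues are constant, or all of them are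
    at least -7.\<close>
  have hi: "high (g i) = high (g 0)" if "i \<le> k" for i
    using e(2)[OF that] e(3) that by (cases "e = 0") fastforce+
  define X0 where "X0 = cnt False (m 1) u - cnt False (m 0) u"
  define X1 where "X1 = V True - 2 * X0"
  have X0: "25 * X0 = e - d"
    using key[of 0] key[of 1] e(2)[of 1] k unfolding X0_def by simp
  have A0: "cnt False (m i) u = cnt False (m 0) u + int i * X0" if "i \<le> k" for i
  proof -
    have "25 * cnt False (m i) u = 25 * cnt False (m 0) u + int i * (25 * X0)"
      unfolding X0 using key[of 0] key[OF that] e(2)[OF that] by (simp add: algebra_simps)
    then show ?thesis by simp
  qed
  have A1: "cnt True (m i) u = cnt True (m 0) u + int i * X1" if "i \<le> k" for i
    using T[OF that] T[of 0] ap[OF that, of True] hi[OF that] A0[OF that]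
    unfolding X1_def by (simp add: algebra_simps)
  have mcuts: "is_cuts k u m (\<lambda>a. if a then X1 else X0)"
    unfolding is_cuts_def
  proof (intro conjI allI impI)
    fix i assume "i < k"
    then have "s i \<le> s (Suc i)" using cuts unfolding is_cuts_def by blast
    then show "m i \<le> m (Suc i)" unfolding m_def by (rule rnd_mono)
  next
    show "m k \<le> length u" unfolding m_def by (rule rnd_le)
  next
    fix i a assume "i \<le> k"
    then show "cnt a (m i) u = cnt a (m 0) u + int i * (if a then X1 else X0)"
      using A0[of i] A1[of i] by (cases a) simp_all
  qed
  \<comment> \<open>A nonzero increment would make \<open>m\<close> the cuts of an abelian power in
    \<open>u\<close>.\<close>
  have X: "X0 = 0" "X1 = 0"
    using cuts_not_abelian_power_free[OF mcuts, of True] cuts_not_abelian_power_free[OF mcuts, of False]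
      free k by auto
  then have VT: "V True = 0" and VF: "V False = e"
    using X0 unfolding X1_def d_def by auto
  have "e \<noteq> 0" using V VT VF by (cases a) auto
  have "V False \<ge> 0"
  proof -
    have "cnt False (s 0) (mor u) \<le> cnt False (s k) (mor u)"
      using is_cuts_le[OF cuts, of 0 k]
      by (metis (no_types) count_list_append le_add1 le_add_diff_inverse le_refl of_nat_mono take_add zero_le)
    then show ?thesis using ap[of k False] k by (simp add: zero_le_mult_iff)
  qed
  with e(1) \<open>e \<noteq> 0\<close> VF have e1: "e = 1" by auto
  have const: "m i = m 0" if "i \<le> k" for i
  proof -
    have "length w = count_list w True + count_list w False" for w :: "bool list"
      by (induction w) auto
    then have "length (take (m i) u) = length (take (m 0) u)"
      using A0[OF that] A1[OF that] X by simp
    moreover have "m i \<le> length u" "m 0 \<le> length u" unfolding m_def by (rule rnd_le)+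
    ultimately show ?thesis by simp
  qed
  have rng: "g 0 \<in> {-7..8}" "g k \<in> {-7..8}" "k \<le> 15" using e(3)[OF \<open>e \<noteq> 0\<close>] by auto
  have gk: "g k = g 0 + int k" using e(2)[of k] e1 by simp
  \<comment> \<open>At least 14 unit steps inside -7 to 8 start at -7 or -6 and end at 7 or 8, on
    opposite sides of the common rounded cut.\<close>
  have "g 0 \<in> {-7..<0}" "5 \<le> g k" using rng gk k by auto
  then have "0 < m 0 \<and> u ! (m 0 - 1)" "m k < length u \<and> u ! m k"
    using rnd_neg rnd_pos unfolding m_def g_def by blast+
  then show ?thesis using const[of k] rng(3) by (intro conjI exI[of _ "m 0 - 1"]) auto
qed

section \<open>The fixed point\<close>

definition iter :: "nat \<Rightarrow> bool list" where
  "iter n = (mor ^^ n) [False]"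

lemma iter_simps [simp]: "iter 0 = [False]" "iter (Suc n) = mor (iter n)"
  by (simp_all add: iter_def)

lemma iter_prefix: "\<exists>y. iter (Suc n) = iter n @ y"
proof (induction n)
  case 0
  show ?case by (simp add: img_def)
next
  case (Suc n)
  then show ?case by (metis iter_simps(2) mor_simps(3))
qed

lemma iter_prefix_le: "n \<le> m \<Longrightarrow> \<exists>y. iter m = iter n @ y"
proof (induction m rule: dec_induct)
  case (step m)
  then show ?case using iter_prefix[of m] by (metis append.assoc)
qed simp

lemma length_mor: "4 * length u \<le> length (mor u)"
  by (induction u) (auto simp: img_def)

lemma length_iter: "n < length (iter n)"
proof (induction n)
  case (Suc n)
  then show ?case using length_mor[of "iter n"] by simp
qed simp

text \<open>Neither image contains 11 and both start with \<open>False\<close>, so none arises at a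
  boundary; the second conjunct carries this through the induction.\<close>

lemma mor_no_adjacent: "successively (\<lambda>a b. \<not> (a \<and> b)) (mor u) \<and> (u \<noteq> [] \<longrightarrow> \<not> hd (mor u))"
  by (induction u) (auto simp: img_def successively_append_iff numeral_eq_Suc)

lemma iter_no_adjacent: "Suc m < length (iter n) \<Longrightarrow> \<not> (iter n ! m \<and> iter n ! Suc m)"
  using mor_no_adjacent[of "iter (n - 1)"]
  by (cases n) (auto simp: successively_conv_nth)

lemma iter_free: "abelian_power_free 14 (iter n)"
proof (induction n)
  case 0
  show ?case by (rule short_abelian_power_free) simp
next
  case (Suc n)
  show ?case
  proof (rule ccontr)
    assume "\<not> ?case"
    then obtain s V a where "is_cuts 14 (mor (iter n)) s V" "V a \<noteq> 0"
      by (auto elim: not_abelian_power_free_cuts)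
    from desubstitute[OF this _ Suc] iter_no_adjacent show False by auto
  qed
qed

text \<open>The limit of the nested prefixes \<open>iter n\<close>: \<open>iter i\<close> has more
  than \<open>i\<close> letters, so its letter at \<open>i\<close> is final.\<close>

definition fixw :: "bool word" where
  "fixw i = iter i ! i"

lemma iter_nth: "i < length (iter n) \<Longrightarrow> iter n ! i = fixw i"
proof -
  assume i: "i < length (iter n)"
  consider "i \<le> n" | "n \<le> i" by linarith
  then show ?thesis
  proof cases
    case 1
    then show ?thesis unfolding fixw_def using iter_prefix_le[OF 1] length_iter[of i]
      by (metis nth_append)
  next
    case 2
    then show ?thesis unfolding fixw_def using iter_prefix_le[OF 2] i
      by (metis nth_append)
  qed
qed

lemma iter_conc: "fixw = iter n \<frown> suffix (length (iter n)) fixw"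
  by (rule ext) (simp add: conc_def iter_nth)

lemma take_iter: "m \<le> length (iter n) \<Longrightarrow> take m (iter n) = map fixw [0..<m]"
  by (rule nth_equalityI) (auto simp: iter_nth)

lemma fixw_fixed: "inf_fixed_point mor fixw"
proof -
  have c: "concat (map (\<lambda>i. mor [fixw i]) [0..<m]) = mor (map fixw [0..<m])" for m
    by (simp add: mor_def comp_def)
  have "\<exists>y. fixw = mor (map fixw [0..<m]) \<frown> y" for m
  proof -
    have "map fixw [0..<m] = take m (iter m)" using take_iter[of m m] length_iter[of m] by simp
    then have "iter (Suc m) = mor (map fixw [0..<m]) @ mor (drop m (iter m))"
      by (metis append_take_drop_id iter_simps(2) mor_simps(3))
    then show ?thesis using iter_conc[of "Suc m"] by (metis conc_conc)
  qed
  moreover have "n \<le> length (mor (map fixw [0..<n]))" for n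
    using length_mor[of "map fixw [0..<n]"] by simp
  ultimately show ?thesis unfolding inf_fixed_point_def inf_image_def c by blast
qed

text \<open>A power ends within a finite prefix of \<open>fixw\<close>, which is also a prefix of
  some \<open>iter n\<close>.\<close>

lemma fixw_free: "abelian_power_free_inf 14 fixw"
  unfolding abelian_power_free_inf_def
proof (intro allI impI)
  fix x vs and y :: "bool word"
  assume a: "fixw = (x @ concat vs) \<frown> y \<and> length vs = 14 \<and>
    (\<forall>v\<in>set vs. \<forall>w\<in>set vs. parikh v = parikh w)"
  let ?z = "x @ concat vs" and ?n = "length (x @ concat vs)"
  have "?z = map fixw [0..<?n]"
  proof (rule nth_equalityI)
    fix i assume i: "i < ?n"
    have "fixw i = (?z \<frown> y) i" using a by metis
    then show "?z ! i = map fixw [0..<?n] ! i" using i by (simp del: append_assoc length_append)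
  qed simp
  then have "?z = take ?n (iter ?n)" using take_iter[of ?n ?n] length_iter[of ?n] by simp
  then have "iter ?n = x @ concat vs @ drop ?n (iter ?n)"
    by (metis append.assoc append_take_drop_id)
  with a iter_free[of ?n] show "\<forall>v\<in>set vs. v = []"
    unfolding abelian_power_free_def by blast
qed

section \<open>The exponents 16 and 15 for the morphism\<close>

lemma mor_free_16: "abelian_power_free 16 u \<Longrightarrow> abelian_power_free 16 (mor u)"
proof (rule ccontr)
  assume u: "abelian_power_free 16 u" and "\<not> abelian_power_free 16 (mor u)"
  then obtain s V a where "is_cuts 16 (mor u) s V" "V a \<noteq> 0"
    by (auto elim: not_abelian_power_free_cuts)
  from desubstitute[OF this _ u] show False by auto
qed

text \<open>The last 7 letters of one image of \<open>True\<close> and the first 8 of the next form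
  a run of 15 letters \<open>False\<close>.\<close>

lemma mor_not_free_15: "\<not> abelian_power_free 15 (mor [True, True])"
proof -
  have "mor [True, True] = (replicate 8 False @ [True]) @ concat (replicate 15 [False]) @ True # replicate 7 False"
    by (simp add: img_def numeral_eq_Suc)
  moreover have "\<forall>v\<in>set (replicate 15 [False]). \<forall>w\<in>set (replicate 15 [False]). parikh v = parikh w"
    by simp
  moreover have "[False] \<in> set (replicate 15 [False])" by simp
  ultimately show ?thesis unfolding abelian_power_free_def
    by (metis length_replicate list.distinct(1))
qed

theorem theorem3p8:
  shows "\<exists>h :: bool list \<Rightarrow> bool list.
     word_morphism h \<and>
     abelian_power_free_morphism 16 h \<and>
     \<not> abelian_power_free_morphism 15 h \<and>
     (\<exists>W :: bool word. inf_fixed_point h W \<and> abelian_power_free_inf 14 W)"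
proof (intro exI conjI)
  show m: "word_morphism mor" by (simp add: word_morphism_def)
  show "abelian_power_free_morphism 16 mor"
    unfolding abelian_power_free_morphism_def using m mor_free_16 by blast
  show "\<not> abelian_power_free_morphism 15 mor"
    unfolding abelian_power_free_morphism_def
    using mor_not_free_15 short_abelian_power_free[of "[True, True]" 15] by auto
  show "inf_fixed_point mor fixw" by (rule fixw_fixed)
  show "abelian_power_free_inf 14 fixw" by (rule fixw_free)
qed

end
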